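(* Let $G$ be a connected, locally finite (possibly infinite) $L_1$-graph on at least three vertices such that $|N(u)\cap N(v)|\ge 2$ for each pair of vertices $u,v$ with $d(u,v)=2$. Then for every cycle $C_n$ of length $n$ in $G$ that does not contain all vertices of $G$, there is a cycle $C_{n+\ell}$ of length $n+\ell$, where $1\le \ell\le 2$, such that $V(C_n)\subset V(C_{n+\ell})$, unless $n=|V(G)|-1$ and $G\in\mathcal{K}$.
   Context: All graphs are simple. $N(u)$ denotes the neighborhood of $u$, $d(u)=|N(u)|$ its degree, and $d(u,v)$ the distance between $u$ and $v$. A graph is locally finite if every vertex has finite degree. A graph $G$ is an $L_1$-graph if $d(u)+d(v)\ge |N(u)\cup N(v)\cup N(w)|-1$ for every triple of vertices $u,v,w$ with $d(u,v)=2$ and $w\in N(u)\cap N(v)$. $\mathcal{K}=\{G : K_{p,p+1}\subseteq G\subseteq K_p\vee\overline{K_{p+1}}\text{ for some }p\ge 2\}$, where $\vee$ denotes the join of graphs and $\overline{K_{p+1}}$ the edgeless graph on $p+1$ vertices (i.e. $G$ is obtained from the complete bipartite graph $K_{p,p+1}$ by possibly adding edges inside the part of size $p$). *)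

theory Defs
  imports "Graph_Theory.Graph_Theory"
begin

text \<open>
  A simple, possibly infinite graph is a \<^typ>\<open>'a pair_pre_digraph\<close> satisfying
  \<^locale>\<open>pair_bidirected_digraph\<close>: arcs are ordered pairs, the arc relation is symmetric and
  irreflexive, and an undirected edge is a pair of opposite arcs.
\<close>

definition nbhd :: "'a pair_pre_digraph \<Rightarrow> 'a \<Rightarrow> 'a set" where
  "nbhd G u = {v. (u, v) \<in> parcs G}"

definition deg :: "'a pair_pre_digraph \<Rightarrow> 'a \<Rightarrow> nat" where
  "deg G u = card (nbhd G u)"

definition locally_finite :: "'a pair_pre_digraph \<Rightarrow> bool" where
  "locally_finite G \<longleftrightarrow> (\<forall>u \<in> pverts G. finite (nbhd G u))"

text \<open>Shortest walk with every arc of cost one; \<^term>\<open>\<infinity>\<close> if there is no walk.\<close>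

definition gdist :: "'a pair_pre_digraph \<Rightarrow> 'a \<Rightarrow> 'a \<Rightarrow> ereal" where
  "gdist G u v = wf_digraph.\<mu> (with_proj G) (\<lambda>_. 1) u v"

text \<open>Degrees and cardinalities are only meaningful here when \<^term>\<open>G\<close> is locally finite.\<close>

definition L1_graph :: "'a pair_pre_digraph \<Rightarrow> bool" where
  "L1_graph G \<longleftrightarrow> pair_bidirected_digraph G \<and>
    (\<forall>u \<in> pverts G. \<forall>v \<in> pverts G. \<forall>w \<in> pverts G.
       gdist G u v = 2 \<and> w \<in> nbhd G u \<inter> nbhd G v \<longrightarrow>
       int (deg G u) + int (deg G v) \<ge> int (card (nbhd G u \<union> nbhd G v \<union> nbhd G w)) - 1)"

text \<open>
  A cycle is given by its arcs. The bound 3 excludes the closed walks traversing a single edge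
  back and forth, which \<^const>\<open>pre_digraph.cycle\<close> admits in a symmetric digraph.
\<close>

definition is_cycle :: "'a pair_pre_digraph \<Rightarrow> nat \<Rightarrow> ('a \<times> 'a) awalk \<Rightarrow> bool" where
  "is_cycle G n C \<longleftrightarrow> pre_digraph.cycle (with_proj G) C \<and> length C = n \<and> 3 \<le> n"

text \<open>Every vertex of a closed walk of positive length is the tail of one of its arcs.\<close>

definition cycle_verts :: "('a \<times> 'a) awalk \<Rightarrow> 'a set" where
  "cycle_verts C = fst ` set C"

text \<open>Intended for graphs with disjoint vertex sets.\<close>

definition graph_join :: "'a pair_pre_digraph \<Rightarrow> 'a pair_pre_digraph \<Rightarrow> 'a pair_pre_digraph" where
  "graph_join A B = \<lparr> pverts = pverts A \<union> pverts B,
     parcs = parcs A \<union> parcs B \<union> pverts A \<times> pverts B \<union> pverts B \<times> pverts A \<rparr>"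

definition edgeless :: "nat \<Rightarrow> 'a pair_pre_digraph \<Rightarrow> bool" where
  "edgeless n B \<longleftrightarrow> finite (pverts B) \<and> card (pverts B) = n \<and> parcs B = {}"

text \<open>
  The containments are containments of copies. Both bounding graphs have
  \<^term>\<open>2 * p + 1\<close> vertices, so they share the vertex set of \<^term>\<open>G\<close>.
\<close>

definition class_K :: "'a pair_pre_digraph set" where
  "class_K = {G. pair_bidirected_digraph G \<and>
     (\<exists>p\<ge>2. \<exists>H A B :: 'a pair_pre_digraph.
        complete_bipartite_digraph p (p + 1) (with_proj H) \<and>
        complete_digraph p (with_proj A) \<and> edgeless (p + 1) B \<and> pverts A \<inter> pverts B = {} \<and>
        subgraph (with_proj H) (with_proj G) \<and>
        subgraph (with_proj G) (with_proj (graph_join A B)))}"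

end

theory Submission
  imports Defs
begin

text \<open>
  Let \<open>v\<close> be a vertex outside the cycle \<open>C\<close> with a neighbour on it, let \<open>s\<close> be the successor map
  of \<open>C\<close> and \<open>W = N v \<inter> V(C)\<close>. If \<open>V(C) \<union> {v}\<close> cannot be covered by a cycle with one or two more
  vertices than \<open>C\<close>, then \<open>insert v (s ` W)\<close> is independent and \<open>v\<close> has no common neighbour with
  \<open>s w\<close> off \<open>C\<close>, for each \<open>w \<in> W\<close>. The \<open>L\<^sub>1\<close> condition for \<open>v\<close> and \<open>s w\<close> then says that \<open>w\<close> has at most as
  many neighbours in \<open>s ` W\<close> as \<open>s w\<close> has in \<open>W\<close>. Summed over \<open>W\<close>, both sides count the edges
  between \<open>W\<close> and \<open>s ` W\<close>, so all these inequalities are equalities. This determines \<open>N w\<close> up to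
  \<open>N v \<union> N (s w)\<close>, and if the predecessor of \<open>w\<close> were not in \<open>s ` W\<close> it would be adjacent to \<open>s w\<close>, so
  that \<open>w\<close> could be bypassed and reinserted elsewhere together with \<open>v\<close>. Hence \<open>C\<close> alternates between
  \<open>W\<close> and \<open>s ` W\<close>. Exchanging \<open>v\<close> with a vertex of \<open>s ` W\<close> and repeating the argument shows that all
  edges between \<open>W\<close> and \<open>insert v (s ` W)\<close> are present and that \<open>G\<close> has no further vertices.
\<close>

subsection \<open>Cyclic lists\<close>

text \<open>The relation is arbitrary so that adjacency, the successor relation and alternation of
  adjacency to \<open>v\<close> all carry over to rotated lists.\<close>

definition circ :: "('a \<Rightarrow> 'a \<Rightarrow> bool) \<Rightarrow> 'a list \<Rightarrow> bool" where
  "circ R xs \<longleftrightarrow> successively R (xs @ [hd xs])"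

definition nxt :: "'a list \<Rightarrow> 'a \<Rightarrow> 'a" where
  "nxt xs x = the (map_of (zip xs (rotate1 xs)) x)"

lemma nxt_nth:
  assumes "distinct xs" "i < length xs"
  shows "nxt xs (xs ! i) = xs ! (Suc i mod length xs)"
  using assms by (simp add: nxt_def map_of_zip_nth nth_rotate1)

lemma circ_iff_nxt:
  assumes "distinct xs" "xs \<noteq> []"
  shows "circ R xs \<longleftrightarrow> (\<forall>x\<in>set xs. R x (nxt xs x))"
proof -
  have *: "(xs @ [hd xs]) ! Suc i = nxt xs (xs ! i)" if "i < length xs" for i
    using that assms
    by (cases "Suc i = length xs") (auto simp: nxt_nth nth_append hd_conv_nth)
  have "circ R xs \<longleftrightarrow> (\<forall>i<length xs. R ((xs @ [hd xs]) ! i) ((xs @ [hd xs]) ! Suc i))"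
    by (simp add: circ_def successively_conv_nth)
  also have "\<dots> \<longleftrightarrow> (\<forall>i<length xs. R (xs ! i) (nxt xs (xs ! i)))"
    using * by (auto simp: nth_append simp del: append_assoc)
  also have "\<dots> \<longleftrightarrow> (\<forall>x\<in>set xs. R x (nxt xs x))"
    by (auto simp: all_set_conv_all_nth)
  finally show ?thesis .
qed

lemma circ_rotate: "circ R (xs @ ys) \<longleftrightarrow> circ R (ys @ xs)"
  by (cases xs; cases ys) (auto simp: circ_def successively_append_iff successively_Cons hd_append)

lemma circ_Cons_hd: "circ R (x # A) \<Longrightarrow> A \<noteq> [] \<Longrightarrow> R x (hd A)"
  by (cases A) (auto simp: circ_def)

lemma circ_Cons_last: "circ R (x # A) \<Longrightarrow> A \<noteq> [] \<Longrightarrow> R (last A) x"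
  by (cases A rule: rev_cases) (auto simp: circ_def successively_append_iff successively_Cons)

lemma nxt_in:
  assumes "distinct xs" "x \<in> set xs"
  shows "nxt xs x \<in> set xs"
  using assms by (auto simp: in_set_conv_nth nxt_nth)
     (metis length_pos_if_in_set mod_less_divisor nth_mem in_set_conv_nth)

lemma nxt_inj:
  assumes "distinct xs"
  shows "inj_on (nxt xs) (set xs)"
proof (rule inj_onI)
  fix x y assume "x \<in> set xs" "y \<in> set xs" and eq: "nxt xs x = nxt xs y"
  then obtain i j where ij: "i < length xs" "x = xs ! i" "j < length xs" "y = xs ! j"
    by (auto simp: in_set_conv_nth)
  then have "0 < length xs" by linarith
  then have "Suc i mod length xs < length xs" "Suc j mod length xs < length xs" by simp_all
  then have "Suc i mod length xs = Suc j mod length xs"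
    using eq ij assms by (simp add: nxt_nth nth_eq_iff_index_eq)
  then have "i = j" using ij by (auto simp: mod_Suc split: if_splits)
  then show "x = y" using ij by simp
qed

text \<open>Iterating \<open>nxt\<close> from any entry runs through the whole list, so a property
  passed on to successors spreads from one vertex to all.\<close>

lemma nxt_closed:
  assumes "distinct xs" "x \<in> set xs" "P x"
    and step: "\<And>y. y \<in> set xs \<Longrightarrow> P y \<Longrightarrow> P (nxt xs y)"
    and "z \<in> set xs"
  shows "P z"
proof -
  obtain i j where ij: "i < length xs" "x = xs ! i" "j < length xs" "z = xs ! j"
    using assms by (auto simp: in_set_conv_nth)
  have "P (xs ! ((i + k) mod length xs))" for k
  proof (induction k)
    case 0
    then show ?case using ij assms by simp
  next
    case (Suc k)
    have lt: "(i + k) mod length xs < length xs" using ij by (intro mod_less_divisor) linarith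
    have "P (nxt xs (xs ! ((i + k) mod length xs)))"
      using step[OF nth_mem[OF lt] Suc] .
    then show ?case using nxt_nth[OF assms(1) lt] by (simp add: mod_Suc_eq)
  qed
  from this[of "length xs - i + j"] show ?thesis using ij by simp
qed

text \<open>Any vertex may come first. The last conclusion keeps \<open>nxt xs\<close>, so that
  neighbours in the new list are recognised as successors in the old one.\<close>

lemma rotate_to:
  assumes "distinct xs" "x \<in> set xs"
  obtains A where "distinct (x # A)" "set (x # A) = set xs" "length (x # A) = length xs"
    "\<And>R. circ R (x # A) \<longleftrightarrow> circ R xs" "circ (\<lambda>a b. nxt xs a = b) (x # A)"
proof -
  obtain B C where BC: "xs = B @ x # C" using assms by (meson split_list)
  have rot: "circ R (x # C @ B) \<longleftrightarrow> circ R xs" for R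
    using circ_rotate[of R B "x # C"] BC by simp
  have "circ (\<lambda>a b. nxt xs a = b) xs"
    using assms by (subst circ_iff_nxt) auto
  then show thesis using that[of "C @ B"] assms BC rot by auto
qed

definition cyc :: "('a \<Rightarrow> 'a \<Rightarrow> bool) \<Rightarrow> 'a list \<Rightarrow> bool" where
  "cyc E xs \<longleftrightarrow> distinct xs \<and> 3 \<le> length xs \<and> circ E xs"

text \<open>
  In terms of \<open>S = insert v (V(C))\<close> with \<open>C\<close> of length \<open>n\<close>: no cycle of length \<open>n + 1\<close> or \<open>n + 2\<close>
  covers \<open>S\<close>. Stated for \<open>S\<close> alone, the condition survives exchanging \<open>v\<close> with a vertex of \<open>C\<close>.
\<close>

definition saturated :: "('a \<Rightarrow> 'a \<Rightarrow> bool) \<Rightarrow> 'a set \<Rightarrow> bool" where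
  "saturated E S \<longleftrightarrow> (\<forall>ys. cyc E ys \<longrightarrow> S \<subseteq> set ys \<longrightarrow> Suc (card S) < length ys)"

subsection \<open>A vertex outside a cycle\<close>

locale adjacency =
  fixes E :: "'a \<Rightarrow> 'a \<Rightarrow> bool"
  assumes E_sym: "E x y \<Longrightarrow> E y x"
    and irrefl: "\<not> E x x"
begin

lemma E_commute: "E x y \<longleftrightarrow> E y x"
  using E_sym by blast

definition N :: "'a \<Rightarrow> 'a set" where
  "N x = {y. E x y}"

lemma N_iff [simp]: "y \<in> N x \<longleftrightarrow> E x y"
  by (simp add: N_def)

lemma successively_E_rev: "successively E (rev xs) \<longleftrightarrow> successively E xs"
  by (simp add: E_commute)

end

locale outside_vertex = adjacency +
  fixes xs :: "'a list" and v :: 'a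
  assumes cyc: "cyc E xs"
    and v_notin: "v \<notin> set xs"
    and sat: "saturated E (insert v (set xs))"
begin

abbreviation s :: "'a \<Rightarrow> 'a" where "s \<equiv> nxt xs"

lemma dist: "distinct xs"
  using cyc by (simp add: cyc_def)

text \<open>Every rerouting below ends here. Covering \<open>insert v (set xs)\<close> already
  forces a longer cycle, so only the upper bound on the length has to be supplied.\<close>

lemma no_extension:
  assumes "distinct ys" "circ E ys" "set ys = insert v (set xs) \<union> T" "length ys \<le> length xs + 2"
  shows False
proof -
  have card: "card (insert v (set xs)) = Suc (length xs)"
    using v_notin dist by (simp add: distinct_card)
  have "card (insert v (set xs)) \<le> card (set ys)"
    using assms(3) by (metis List.finite_set Un_upper1 Un_insert_left card_mono)
  then have "length xs < length ys" using card assms(1) by (simp add: distinct_card)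
  then have "cyc E ys" using assms cyc by (simp add: cyc_def)
  then show False using sat assms card unfolding saturated_def by fastforce
qed

lemma rotate_cycle:
  assumes "x \<in> set xs"
  obtains A where "distinct (x # A)" "set (x # A) = set xs" "length (x # A) = length xs"
    "circ E (x # A)" "circ (\<lambda>a b. s a = b) (x # A)" "\<forall>R. circ R (x # A) \<longleftrightarrow> circ R xs"
  using rotate_to[OF dist assms] cyc unfolding cyc_def by metis

lemma rotate_cycle_Cons:
  assumes "x \<in> set xs"
  obtains A where "distinct (x # s x # A)" "set (x # s x # A) = set xs"
    "length (x # s x # A) = length xs" "circ E (x # s x # A)" "circ (\<lambda>a b. s a = b) (x # s x # A)"
    "\<forall>R. circ R (x # s x # A) \<longleftrightarrow> circ R xs"
proof -
  obtain A where A: "distinct (x # A)" "set (x # A) = set xs" "length (x # A) = length xs"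
    "circ E (x # A)" "circ (\<lambda>a b. s a = b) (x # A)" "\<forall>R. circ R (x # A) \<longleftrightarrow> circ R xs"
    using rotate_cycle[OF assms] .
  have "A \<noteq> []" using A(3) cyc by (auto simp: cyc_def)
  then obtain y B where "A = y # B" by (cases A) auto
  moreover have "y = s x" using A(5) \<open>A = y # B\<close> by (simp add: circ_def)
  ultimately show thesis using that A by blast
qed

lemma s_nbr:
  assumes "x \<in> set xs"
  shows "E x (s x)"
proof -
  have "xs \<noteq> []" using assms by auto
  then show ?thesis using circ_iff_nxt[OF dist, of E] cyc assms by (simp add: cyc_def)
qed

lemma not_E_succ:
  assumes "w \<in> set xs" "E v w"
  shows "\<not> E v (s w)"
proof
  assume vs: "E v (s w)"
  obtain A where A: "distinct (w # s w # A)" "set (w # s w # A) = set xs"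
    "length (w # s w # A) = length xs" "circ E (w # s w # A)" "circ (\<lambda>a b. s a = b) (w # s w # A)"
    using rotate_cycle_Cons[OF assms(1)] .
  show False
    by (rule no_extension[of "w # v # s w # A" "{}"])
      (use A v_notin assms vs in \<open>auto simp: circ_def E_commute successively_Cons\<close>)
qed

text \<open>Otherwise the path \<open>w\<close>, \<open>v\<close>, \<open>z\<close>,
  \<open>s w\<close> can replace the edge from \<open>w\<close> to \<open>s w\<close>, which adds
  two vertices.\<close>

lemma common_nbr_in:
  assumes "w \<in> set xs" "E v w" "E v z" "E (s w) z"
  shows "z \<in> set xs"
proof (rule ccontr)
  assume z: "z \<notin> set xs"
  have "z \<noteq> v" using assms irrefl by auto
  obtain A where A: "distinct (w # s w # A)" "set (w # s w # A) = set xs"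
    "length (w # s w # A) = length xs" "circ E (w # s w # A)" "circ (\<lambda>a b. s a = b) (w # s w # A)"
    using rotate_cycle_Cons[OF assms(1)] .
  show False
    by (rule no_extension[of "w # v # z # s w # A" "{z}"])
      (use A v_notin assms z \<open>z \<noteq> v\<close> in \<open>auto simp: circ_def E_commute successively_Cons\<close>)
qed

text \<open>Otherwise go from \<open>w\<close> through \<open>v\<close> to \<open>w'\<close>,
  backwards along the cycle to \<open>s w\<close>, across to \<open>s w'\<close> and forwards to
  \<open>w\<close>: this cycle takes in \<open>v\<close>.\<close>

lemma succ_independent:
  assumes "w \<in> set xs" "E v w" "w' \<in> set xs" "E v w'"
  shows "\<not> E (s w) (s w')"
proof
  assume E: "E (s w) (s w')"
  then have "w \<noteq> w'" using irrefl by auto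
  obtain A where A: "distinct (w # s w # A)" "set (w # s w # A) = set xs"
    "length (w # s w # A) = length xs" "circ E (w # s w # A)" "circ (\<lambda>a b. s a = b) (w # s w # A)"
    using rotate_cycle_Cons[OF assms(1)] .
  have "w' \<noteq> s w" using not_E_succ assms by auto
  then have "w' \<in> set A" using A(2) assms \<open>w \<noteq> w'\<close> by auto
  then obtain B C where BC: "A = B @ w' # C" by (meson split_list)
  \<comment> \<open>\<open>w'\<close> does not precede \<open>w\<close> on the cycle, since
    \<open>v\<close> is adjacent to \<open>w\<close> but not to \<open>s w'\<close>.\<close>
  have "C \<noteq> []"
  proof
    assume "C = []"
    then have "s w' = w" using A(5) BC by (simp add: circ_def successively_append_iff successively_Cons split: if_splits)
    then show False using not_E_succ assms by auto
  qed
  then obtain z D where C: "C = z # D" by (cases C) auto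
  have z: "z = s w'" using A(5) BC C
    by (simp add: circ_def successively_append_iff successively_Cons)
  have E': "successively E (s w # B)" "successively E (z # D @ [w])" "successively E ((s w # B) @ [w'])"
  proof -
    have "successively E ([w] @ (s w # B) @ (w' # []) @ (z # D @ [w]))"
      "successively E ([w] @ ((s w # B) @ [w']) @ (z # D @ [w]))"
      using A(4) unfolding BC C circ_def by simp_all
    then show "successively E (s w # B)" "successively E (z # D @ [w])"
      "successively E ((s w # B) @ [w'])"
      unfolding successively_append_iff[of E "[w]"] successively_append_iff[of E "s w # B"]
        successively_append_iff[of E "(s w # B) @ [w']"] successively_append_iff[of E "[w']"]
      by blast+
  qed
  have "successively E (w' # rev (s w # B))"
    using E'(3) successively_E_rev[of "(s w # B) @ [w']"] by simp
  then have "circ E (w # v # w' # rev (s w # B) @ z # D)"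
    using E'(2) assms E z
    by (auto simp: circ_def successively_append_iff successively_Cons hd_append E_commute)
  then show False
    by (rule no_extension[of "w # v # w' # rev (s w # B) @ z # D" "{}", rotated])
      (use A v_notin BC C in \<open>auto\<close>)
qed

text \<open>The edge from \<open>p\<close> to \<open>s a\<close> bypasses \<open>a\<close>, which
  then returns together with \<open>v\<close>: the path \<open>w\<close>, \<open>v\<close>,
  \<open>a\<close>, \<open>s w\<close> replaces the edge from \<open>w\<close> to
  \<open>s w\<close>.\<close>

lemma no_chord:
  assumes "p \<in> set xs" "s p = a" "E v a" "E p (s a)" "w \<in> set xs" "E v w" "w \<noteq> a" "E a (s w)"
  shows False
proof -
  have a: "a \<in> set xs" using nxt_in[OF dist assms(1)] assms(2) by simp
  have wp: "w \<noteq> p" using not_E_succ[OF assms(5,6)] assms(2,3) by auto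
  obtain A where A: "distinct (a # A)" "set (a # A) = set xs" "length (a # A) = length xs"
    "circ E (a # A)" "circ (\<lambda>a b. s a = b) (a # A)"
    using rotate_cycle[OF a] .
  have "A \<noteq> []" using A(3) cyc by (auto simp: cyc_def)
  have lastA: "last A = p"
  proof -
    have "s (last A) = a" by (rule circ_Cons_last[OF A(5) \<open>A \<noteq> []\<close>])
    moreover have "last A \<in> set xs" unfolding A(2)[symmetric] using \<open>A \<noteq> []\<close> by simp
    ultimately show ?thesis using inj_onD[OF nxt_inj[OF dist], of "last A" p] assms(1,2) by simp
  qed
  have hdA: "hd A = s a" using circ_Cons_hd[OF A(5) \<open>A \<noteq> []\<close>] by simp
  have "w \<in> set A" using A(2) assms by auto
  then obtain B C where BC: "A = B @ w # C" by (meson split_list)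
  have "C \<noteq> []" using lastA wp BC by auto
  then obtain z D where C: "C = z # D" by (cases C) auto
  have z: "z = s w" using A(5) BC C
    by (simp add: circ_def successively_append_iff successively_Cons)
  have path: "successively E (B @ [w])" "successively E (z # D)"
  proof -
    have "successively E ([a] @ (B @ [w]) @ (z # D) @ [a])"
      using A(4) unfolding BC C circ_def by simp
    then show "successively E (B @ [w])" "successively E (z # D)"
      unfolding successively_append_iff[of E "[a]"] successively_append_iff[of E "B @ [w]"]
        successively_append_iff[of E "z # D"] by blast+
  qed
  \<comment> \<open>The new cycle closes along the bypass: it ends in \<open>p\<close> and starts in
    \<open>s a\<close>, also when \<open>B\<close> is empty and \<open>w = s a\<close>.\<close>
  have chord: "E (last (z # D)) (hd (B @ [w]))"
    using assms(4) hdA lastA unfolding BC C by (simp add: hd_append split: if_splits)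
  have "hd (B @ w # v # a # z # D) = hd (B @ [w])" by (simp add: hd_append)
  moreover have "E a z" "E w v" using assms z by (simp_all add: E_commute)
  moreover have "successively E ((B @ [w]) @ [v, a] @ (z # D) @ [hd (B @ [w])])"
    unfolding successively_append_iff[of E "B @ [w]"] successively_append_iff[of E "[v, a]"]
      successively_append_iff[of E "z # D"]
    using path chord calculation(2,3) assms(3) by auto
  ultimately have "circ E (B @ w # v # a # z # D)"
    unfolding circ_def by simp
  then show False
    by (rule no_extension[of "B @ w # v # a # z # D" "{}", rotated])
      (use A v_notin BC C in \<open>auto\<close>)
qed

end

section \<open>Counting neighbours with the L1 condition\<close>

text \<open>Distance two becomes nonadjacency with a common neighbour. As d(u) + d(v) counts the
  union once and the intersection once more, the L1 inequality takes the form of a bound on the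
  neighbours of \<open>w\<close> outside the union.\<close>

locale ore = adjacency +
  assumes finite_N: "finite (N x)"
    and two_common: "u \<noteq> v \<Longrightarrow> \<not> E u v \<Longrightarrow> E u w \<Longrightarrow> E v w \<Longrightarrow> 2 \<le> card (N u \<inter> N v)"
    and L1: "u \<noteq> v \<Longrightarrow> \<not> E u v \<Longrightarrow> E u w \<Longrightarrow> E v w \<Longrightarrow>
      card (N w - (N u \<union> N v)) \<le> Suc (card (N u \<inter> N v))"

locale ore_outside = ore + outside_vertex +
  fixes x0 :: 'a
  assumes x0: "x0 \<in> set xs" "E v x0"
begin

definition W :: "'a set" where
  "W = N v \<inter> set xs"

lemma W_iff: "w \<in> W \<longleftrightarrow> w \<in> set xs \<and> E v w"
  by (auto simp: W_def)

lemma finite_W: "finite W"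
  by (simp add: W_def)

lemma s_inj_W: "inj_on s W"
  using nxt_inj[OF dist] by (rule inj_on_subset) (auto simp: W_def)

lemma succ_nonadjacent:
  assumes "w \<in> W"
  shows "v \<noteq> s w" "\<not> E v (s w)" "E v w" "E (s w) w"
  using assms nxt_in[OF dist] v_notin not_E_succ s_nbr E_commute by (auto simp: W_iff)

lemma common_eq:
  assumes "w \<in> W"
  shows "N v \<inter> N (s w) = W \<inter> N (s w)"
  using assms common_nbr_in by (auto simp: W_iff)

lemma private_nbrs:
  assumes "w \<in> W"
  shows "insert v (s ` W \<inter> N w) \<subseteq> N w - (N v \<union> N (s w))"
  using assms succ_nonadjacent[OF assms] not_E_succ succ_independent irrefl E_commute
  by (auto simp: W_iff)

lemma L1_bound:
  assumes "w \<in> W"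
  shows "card (s ` W \<inter> N w) \<le> card (W \<inter> N (s w))"
proof -
  \<comment> \<open>Being distinct from all successors, \<open>v\<close> is one further private
    neighbour of \<open>w\<close>; it cancels the \<open>Suc\<close> in \<open>L1\<close>.\<close>
  have "v \<notin> s ` W" using succ_nonadjacent by auto
  then have "Suc (card (s ` W \<inter> N w)) = card (insert v (s ` W \<inter> N w))"
    using finite_W by simp
  also have "\<dots> \<le> card (N w - (N v \<union> N (s w)))"
    using private_nbrs[OF assms] finite_N by (intro card_mono) auto
  also have "\<dots> \<le> Suc (card (N v \<inter> N (s w)))"
    using succ_nonadjacent[OF assms] by (intro L1)
  finally show ?thesis using common_eq[OF assms] by simp
qed

text \<open>Double counting of the edges between \<open>W\<close> and its successors; injectivity of
  \<open>s\<close> turns a sum over successors into one over \<open>W\<close>.\<close>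

lemma L1_sum: "(\<Sum>w\<in>W. card (s ` W \<inter> N w)) = (\<Sum>w\<in>W. card (W \<inter> N (s w)))"
proof -
  have "(\<Sum>w\<in>W. card (s ` W \<inter> N w)) = (\<Sum>w\<in>W. \<Sum>y\<in>s ` W. if E w y then 1 else 0)"
    using finite_W by (intro sum.cong refl) (simp add: sum.If_cases N_def Int_def)
  also have "\<dots> = (\<Sum>y\<in>s ` W. \<Sum>w\<in>W. if E y w then 1 else 0)"
    by (subst sum.swap) (simp add: E_commute)
  also have "\<dots> = (\<Sum>y\<in>s ` W. card (W \<inter> N y))"
    using finite_W by (intro sum.cong refl) (simp add: sum.If_cases N_def Int_def)
  also have "\<dots> = (\<Sum>w\<in>W. card (W \<inter> N (s w)))"
    by (simp add: sum.reindex[OF s_inj_W])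
  finally show ?thesis .
qed

lemma L1_tight:
  assumes "w \<in> W"
  shows "card (s ` W \<inter> N w) = card (W \<inter> N (s w))"
  using sum_mono_inv[OF L1_sum L1_bound assms finite_W] by simp

text \<open>\<open>two_common\<close> yields two neighbours of \<open>s w\<close> in
  \<open>W\<close>, and tightness transfers this count to \<open>w\<close>.\<close>

lemma two_succ_nbrs:
  assumes "w \<in> W"
  shows "2 \<le> card (s ` W \<inter> N w)"
  using two_common[OF succ_nonadjacent[OF assms]] common_eq[OF assms] L1_tight[OF assms] by simp

text \<open>Tightness leaves no slack in \<open>L1\<close>, so the inclusion of
  \<open>private_nbrs\<close> is one between finite sets of the same size.\<close>

lemma nbrs_eq:
  assumes "w \<in> W"
  shows "N w - (N v \<union> N (s w)) = insert v (s ` W \<inter> N w)"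
proof (rule sym[OF card_subset_eq])
  show "insert v (s ` W \<inter> N w) \<subseteq> N w - (N v \<union> N (s w))"
    by (rule private_nbrs[OF assms])
  show fin: "finite (N w - (N v \<union> N (s w)))" using finite_N by simp
  have "v \<notin> s ` W" using succ_nonadjacent by auto
  then have "card (insert v (s ` W \<inter> N w)) = Suc (card (s ` W \<inter> N w))"
    using finite_W by simp
  moreover have "card (N w - (N v \<union> N (s w))) \<le> Suc (card (s ` W \<inter> N w))"
    using L1[OF succ_nonadjacent[OF assms]] common_eq[OF assms] L1_tight[OF assms] by simp
  moreover have "card (insert v (s ` W \<inter> N w)) \<le> card (N w - (N v \<union> N (s w)))"
    using private_nbrs[OF assms] fin by (rule card_mono[rotated])
  ultimately show "card (insert v (s ` W \<inter> N w)) = card (N w - (N v \<union> N (s w)))" by simp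
qed

section \<open>Alternation around the cycle and its consequences\<close>

lemma pred_in_succ:
  assumes "p \<in> set xs" "s p \<in> W"
  shows "p \<in> s ` W"
proof (rule ccontr)
  assume p: "p \<notin> s ` W"
  have "\<not> E v p" using not_E_succ assms by (auto simp: W_iff)
  moreover have "p \<noteq> v" using assms v_notin by auto
  moreover have "E (s p) p" using s_nbr assms E_commute by auto
  \<comment> \<open>\<open>p\<close> is a neighbour of \<open>s p\<close> that is missing on the
    right of \<open>nbrs_eq\<close> and not adjacent to \<open>v\<close>, so it must be adjacent to
    \<open>s (s p)\<close>.\<close>
  ultimately have chord: "E (s (s p)) p" using nbrs_eq[OF assms(2)] p by auto
  \<comment> \<open>Among the successors adjacent to \<open>s p\<close> there is some
    \<open>s w\<close> other than \<open>s (s p)\<close>; \<open>s p\<close> will be reinserted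
    before it.\<close>
  have "\<not> s ` W \<inter> N (s p) \<subseteq> {s (s p)}"
    using two_succ_nbrs[OF assms(2)] card_mono[of "{s (s p)}" "s ` W \<inter> N (s p)"] by auto
  then obtain y where "y \<in> s ` W \<inter> N (s p)" "y \<noteq> s (s p)" by blast
  then obtain w where "w \<in> W" "E (s p) (s w)" "w \<noteq> s p" by auto
  then show False
    using no_chord[OF assms(1) refl, of w] assms chord E_commute by (auto simp: W_iff)
qed

text \<open>By \<open>pred_in_succ\<close> every vertex of \<open>W\<close> lies two steps after a
  vertex of \<open>W\<close>; injectivity of \<open>s\<close> and finiteness do the rest.\<close>

lemma W_succ_succ: "(\<lambda>w. s (s w)) ` W = W"
proof (rule sym[OF card_subset_eq])
  have inj: "inj_on (\<lambda>w. s (s w)) W"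
    using nxt_in[OF dist] inj_onD[OF nxt_inj[OF dist]] by (auto simp: W_iff inj_on_def)
  show "W \<subseteq> (\<lambda>w. s (s w)) ` W"
  proof
    fix a assume a: "a \<in> W"
    have "s ` set xs = set xs"
      using nxt_inj[OF dist] nxt_in[OF dist] by (intro endo_inj_surj) auto
    moreover have "a \<in> set xs" using a by (simp add: W_iff)
    ultimately obtain p where "p \<in> set xs" "s p = a" by (metis imageE)
    then show "a \<in> (\<lambda>w. s (s w)) ` W" using pred_in_succ a by auto
  qed
  show "finite ((\<lambda>w. s (s w)) ` W)" using finite_W by simp
  show "card W = card ((\<lambda>w. s (s w)) ` W)" using inj by (simp add: card_image)
qed

lemma verts_eq: "set xs = W \<union> s ` W"
proof
  show "W \<union> s ` W \<subseteq> set xs" using nxt_in[OF dist] by (auto simp: W_iff)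
  have "y \<in> W \<union> s ` W" if "y \<in> set xs" for y
  proof (rule nxt_closed[OF dist x0(1) _ _ that])
    show "x0 \<in> W \<union> s ` W" using x0 by (simp add: W_iff)
    show "s y \<in> W \<union> s ` W" if "y \<in> W \<union> s ` W" for y
      using that W_succ_succ by auto
  qed
  then show "set xs \<subseteq> W \<union> s ` W" by blast
qed

lemma W_disjoint: "W \<inter> s ` W = {}"
  using not_E_succ by (auto simp: W_iff)

lemma complement_eq: "set xs - W = s ` W"
  using verts_eq W_disjoint by auto

lemma alternating:
  assumes "x \<in> set xs"
  shows "E v (s x) \<longleftrightarrow> \<not> E v x"
proof (cases "x \<in> W")
  case True
  then show ?thesis using not_E_succ by (auto simp: W_iff)
next
  case False
  then have "s x \<in> W" using verts_eq assms W_succ_succ by auto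
  then show ?thesis using False assms by (auto simp: W_iff)
qed

lemma independent:
  assumes "x \<in> set xs - W" "y \<in> set xs - W"
  shows "\<not> E x y"
  using assms succ_independent unfolding complement_eq by (auto simp: W_iff)

lemma card_complement: "card (set xs - W) = card W"
  unfolding complement_eq by (rule card_image[OF s_inj_W])

lemma two_le_card_W: "2 \<le> card W"
proof -
  have "x0 \<in> W" using x0 by (simp add: W_iff)
  then have "2 \<le> card (s ` W \<inter> N x0)" by (rule two_succ_nbrs)
  also have "\<dots> \<le> card (s ` W)" using finite_W by (intro card_mono) auto
  also have "\<dots> \<le> card W" by (rule card_image_le[OF finite_W])
  finally show ?thesis .
qed

text \<open>
  Putting \<open>v\<close> in the place of \<open>x\<close> leaves \<open>V(C) \<union> {v}\<close> unchanged, so the new cycle with the outside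
  vertex \<open>x\<close> satisfies the same hypotheses.
\<close>

lemma exchange:
  assumes x: "x \<in> set xs - W"
  obtains w ys where "w \<in> W" "x = s w" "ore_outside E ys x w"
    "set ys = insert v (set xs - {x})" "nxt ys w = v"
    "\<And>z. z \<in> set ys \<Longrightarrow> E x z \<longleftrightarrow> E v z"
proof -
  obtain w where w: "w \<in> W" "x = s w" using x unfolding complement_eq by auto
  then have wxs: "w \<in> set xs" by (simp add: W_iff)
  obtain A where A: "distinct (w # s w # A)" "set (w # s w # A) = set xs"
    "length (w # s w # A) = length xs" "circ E (w # s w # A)" "circ (\<lambda>a b. s a = b) (w # s w # A)"
    "\<forall>R. circ R (w # s w # A) \<longleftrightarrow> circ R xs"
    using rotate_cycle_Cons[OF wxs] .
  have vx: "\<not> E v x" "v \<noteq> x" using succ_nonadjacent w by auto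
  have alt: "circ (\<lambda>a b. E v b \<longleftrightarrow> \<not> E v a) xs"
    using alternating wxs by (subst circ_iff_nxt[OF dist]) auto
  define ys where "ys = w # v # A"
  have "A \<noteq> []" using A(3) cyc by (auto simp: cyc_def)
  then obtain z B where zB: "A = z # B" by (cases A) auto
  have sx: "s x = z" using A(5) w unfolding zB circ_def by simp
  have "E v z" using alternating[of x] x vx sx by auto
  then have "circ E ys" using A(4) w unfolding ys_def circ_def zB by (simp add: W_iff E_commute)
  have "w \<noteq> x" using A(1) w(2) by auto
  have setA: "set A = set xs - {x, w}" unfolding A(2)[symmetric] w(2) using A(1) by auto
  have set_ys: "set ys = insert v (set xs - {x})"
    using setA wxs \<open>w \<noteq> x\<close> by (auto simp: ys_def)
  have dys: "distinct ys" using A(1) setA v_notin wxs by (auto simp: ys_def)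
  have "length ys = length xs" using A(3) by (simp add: ys_def)
  then have cys: "cyc E ys" using dys \<open>circ E ys\<close> cyc by (simp add: cyc_def)
  have "insert x (set ys) = insert v (set xs)" using set_ys x by auto
  then have sys: "saturated E (insert x (set ys))" using sat by simp
  have "x \<notin> set ys" using set_ys vx by auto
  have out: "ore_outside E ys x w"
    using cys sys \<open>x \<notin> set ys\<close> w s_nbr[OF wxs] E_commute
    by unfold_locales (auto simp: ys_def)
  interpret o: ore_outside E ys x w by (rule out)
  \<comment> \<open>Neither \<open>x\<close> nor \<open>v\<close> is adjacent to \<open>v\<close>,
    so substituting one for the other preserves the alternation.\<close>
  have "circ (\<lambda>a b. E v b \<longleftrightarrow> \<not> E v a) (w # x # A)"
    using alt A(6) unfolding w(2) by blast
  then have "circ (\<lambda>a b. E v b \<longleftrightarrow> \<not> E v a) ys"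
    using vx irrefl unfolding ys_def circ_def zB by simp
  then have alt': "E v (nxt ys z) \<longleftrightarrow> \<not> E v z" if "z \<in> set ys" for z
    using circ_iff_nxt[OF dys, of "\<lambda>a b. E v b \<longleftrightarrow> \<not> E v a"] that by (auto simp: ys_def)
  \<comment> \<open>Along \<open>ys\<close> adjacency to \<open>x\<close> and adjacency to
    \<open>v\<close> both alternate, and they agree at \<open>w\<close>.\<close>
  have same: "E x z \<longleftrightarrow> E v z" if "z \<in> set ys" for z
  proof (rule nxt_closed[OF dys _ _ _ that])
    show "w \<in> set ys" by (simp add: ys_def)
    show "E x w \<longleftrightarrow> E v w" using w s_nbr[OF wxs] E_commute by (auto simp: W_iff)
    show "E x (nxt ys y) \<longleftrightarrow> E v (nxt ys y)" if "y \<in> set ys" "E x y \<longleftrightarrow> E v y" for y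
      using that o.alternating alt' by blast
  qed
  have "nxt ys w = v" by (simp add: nxt_def ys_def)
  then show thesis using that w out set_ys same by blast
qed

lemma complete:
  assumes "x \<in> set xs - W" "w \<in> W"
  shows "E x w"
proof -
  obtain ys where ys: "set ys = insert v (set xs - {x})"
      "\<And>z. z \<in> set ys \<Longrightarrow> E x z \<longleftrightarrow> E v z"
    using exchange[OF assms(1)] by metis
  have "w \<in> set ys" using ys(1) assms by (auto simp: W_iff)
  then show ?thesis using ys(2) assms by (simp add: W_iff)
qed

text \<open>Adjacency to \<open>y\<close> also alternates along the cycle, in phase with adjacency
  to \<open>v\<close> or opposite to it. Since \<open>y\<close> may be adjacent to \<open>v\<close>,
  an exchange first puts \<open>v\<close> on the cycle and some \<open>x\<close> outside;
  \<open>x\<close> and a successor \<open>x2\<close> on \<open>ys\<close> then yield the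
  contradiction.\<close>

lemma no_other_nbr:
  assumes y: "y \<notin> set xs" "y \<noteq> v" and sat_y: "saturated E (insert y (set xs))"
    and b: "b \<in> set xs"
  shows "\<not> E y b"
proof
  assume "E y b"
  then interpret y: ore_outside E xs y b
    using cyc y sat_y b by unfold_locales auto
  have "card (set xs - W) \<noteq> 0" using card_complement two_le_card_W by simp
  then have "set xs - W \<noteq> {}" by (metis card.empty)
  then obtain x where x: "x \<in> set xs - W" by blast
  obtain w ys where ys: "w \<in> W" "x = s w" "ore_outside E ys x w"
    "set ys = insert v (set xs - {x})" "nxt ys w = v"
    "\<And>z. z \<in> set ys \<Longrightarrow> E x z \<longleftrightarrow> E v z"
    using exchange[OF x] by metis
  interpret o: ore_outside E ys x w by (rule ys(3))
  \<comment> \<open>With \<open>w2\<close> different from \<open>w\<close>, its successor on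
    \<open>ys\<close> is not \<open>v\<close>, so the phase of \<open>y\<close> decides whether they
    are adjacent.\<close>
  have "\<not> W \<subseteq> {w}" using two_le_card_W card_mono[of "{w}" W] by auto
  then obtain w2 where w2: "w2 \<in> W" "w2 \<noteq> w" by auto
  have mem: "w \<in> set ys" "w2 \<in> set ys" using ys(1,4) x w2 by (auto simp: W_iff)
  define x2 where "x2 = nxt ys w2"
  have w2o: "w2 \<in> o.W" using w2 mem ys(6) by (simp add: o.W_iff W_iff)
  have "x2 \<noteq> v"
    using inj_onD[OF nxt_inj[OF o.dist] _ mem] ys(5) w2(2) unfolding x2_def by auto
  moreover have "x2 \<in> set ys" unfolding x2_def by (rule nxt_in[OF o.dist mem(2)])
  moreover have "\<not> E x x2" using o.succ_nonadjacent[OF w2o] by (simp add: x2_def)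
  ultimately have x2: "x2 \<in> set xs - W" using ys(4,6) by (auto simp: W_iff)
  show False
  proof (cases "E y b \<longleftrightarrow> E v b")
    \<comment> \<open>In phase, \<open>y\<close> is adjacent to \<open>w2\<close> but not to
      \<open>x\<close> or \<open>x2\<close>, so \<open>nbrs_eq\<close> would make it
      \<open>x\<close> or place it on \<open>ys\<close>.\<close>
    case True
    have same: "E y z \<longleftrightarrow> E v z" if "z \<in> set xs" for z
    proof (rule nxt_closed[OF dist b _ _ that])
      show "E y b \<longleftrightarrow> E v b" by (rule True)
      show "E y (s a) \<longleftrightarrow> E v (s a)" if "a \<in> set xs" "E y a \<longleftrightarrow> E v a" for a
        using that alternating y.alternating by blast
    qed
    have "y \<in> N w2" using same w2 E_commute by (auto simp: W_iff)
    moreover have "y \<notin> N x" "y \<notin> N x2"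
      using same x x2 E_commute by (auto simp: W_iff)
    moreover have "y \<noteq> x" using x y by auto
    moreover have "y \<notin> set ys" using ys(4) y by auto
    ultimately show False
      using o.nbrs_eq[OF w2o] nxt_in[OF o.dist] unfolding x2_def by (auto simp: o.W_iff)
  next
    \<comment> \<open>In opposite phase, \<open>y\<close> is a common neighbour of \<open>x\<close>
      and \<open>x2\<close> off \<open>ys\<close>.\<close>
    case False
    have opp: "E y z \<longleftrightarrow> \<not> E v z" if "z \<in> set xs" for z
    proof (rule nxt_closed[OF dist b _ _ that])
      show "E y b \<longleftrightarrow> \<not> E v b" using False by blast
      show "E y (s a) \<longleftrightarrow> \<not> E v (s a)" if "a \<in> set xs" "E y a \<longleftrightarrow> \<not> E v a" for a
        using that alternating y.alternating by blast
    qed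
    have "E x y" "E x2 y" using opp x x2 E_commute by (auto simp: W_iff)
    then have "y \<in> set ys"
      using o.common_nbr_in[OF mem(2)] w2o unfolding x2_def by (simp add: o.W_iff)
    then show False using ys(4) y by auto
  qed
qed

end

locale ore_stuck = ore_outside +
  assumes stuck: "y \<notin> set xs \<Longrightarrow> saturated E (insert y (set xs))"
begin

text \<open>By \<open>no_other_nbr\<close> only \<open>v\<close> could have a neighbour
  \<open>b\<close> further out. Then \<open>b\<close> and \<open>x0\<close> share \<open>v\<close>,
  hence also a second vertex, which can lie neither on the cycle nor off it.\<close>

lemma closed:
  assumes "E a b" "a \<in> insert v (set xs)"
  shows "b \<in> insert v (set xs)"
proof (rule ccontr)
  assume b: "b \<notin> insert v (set xs)"
  have none: "\<not> E y z" if "y \<notin> insert v (set xs)" "z \<in> set xs" for y z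
    using no_other_nbr[of y z] stuck that by auto
  then have a: "a = v" using assms b E_commute by blast
  have "b \<noteq> x0" "\<not> E b x0" "E b v" "E x0 v"
    using none[OF b] x0 b assms a E_commute by auto
  from two_common[OF this] have "\<not> N b \<inter> N x0 \<subseteq> {v}"
    using card_mono[of "{v}" "N b \<inter> N x0"] by auto
  then obtain y where "y \<in> N b \<inter> N x0" "y \<noteq> v" by blast
  then have y: "E b y" "E x0 y" by simp_all
  then show False using none[OF b, of y] none[of y x0] x0 \<open>y \<noteq> v\<close> E_commute by blast
qed

end

subsection \<open>Arc cycles, distances and the class \<open>\<K>\<close>\<close>

lemma pcas_successively:
  assumes "pcas u C v" "set C \<subseteq> A" "C \<noteq> []"
  shows "successively (\<lambda>a b. (a, b) \<in> A) (map fst C @ [v])"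
  using assms
proof (induction C arbitrary: u)
  case (Cons e es)
  then show ?case by (cases e; cases es) auto
qed simp

lemma pcas_zip:
  assumes "successively (\<lambda>a b. (a, b) \<in> A) (u # zs)"
  shows "pcas u (zip (u # zs) zs) (last (u # zs))" "set (zip (u # zs) zs) \<subseteq> A"
proof -
  have "pcas u (zip (u # zs) zs) (last (u # zs)) \<and> set (zip (u # zs) zs) \<subseteq> A"
    using assms
  proof (induction zs arbitrary: u)
    case (Cons z zs)
    then show ?case by (simp add: successively_Cons)
  qed simp
  then show "pcas u (zip (u # zs) zs) (last (u # zs))" "set (zip (u # zs) zs) \<subseteq> A" by auto
qed

lemma is_cycle_imp_cyc:
  assumes "pair_wf_digraph G" "is_cycle G n C"
  shows "cyc (\<lambda>a b. (a, b) \<in> parcs G) (map fst C)" "length C = n" "cycle_verts C \<subseteq> pverts G"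
proof -
  interpret pair_wf_digraph G by fact
  obtain u where u: "awalk u C u" "distinct (tl (awalk_verts u C))" "C \<noteq> []" "length C = n" "3 \<le> n"
    using assms(2) unfolding is_cycle_def cycle_def by blast
  have cas: "pcas u C u" and sub: "set C \<subseteq> parcs G" using u(1) by (auto simp: awalk_def)
  have v: "map fst C @ [snd (last C)] = fst (hd C) # map snd C"
    using awalk_verts_conv[of u C] awalk_verts_conv'[OF cas] u(3) by simp
  have hd: "fst (hd C) = u" using cas u(3) by (cases C) auto
  have "distinct (map snd C)" using u(2,3) awalk_verts_conv'[OF cas] by simp
  \<comment> \<open>The library asks for distinct heads, while \<open>cycle_verts\<close> uses
    tails; in a closed walk both form the same multiset.\<close>
  moreover have "mset (map fst C) = mset (map snd C)"
  proof -
    have "snd (last C) = u" using awlast_if_cas[OF cas] awalk_verts_conv[of u C] u(3) by simp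
    then show ?thesis using arg_cong[OF v, of mset] hd by simp
  qed
  ultimately have "distinct (map fst C)" by (metis mset_eq_imp_distinct_iff)
  moreover have "circ (\<lambda>a b. (a, b) \<in> parcs G) (map fst C)"
    using pcas_successively[OF cas sub u(3)] hd u(3) by (simp add: circ_def hd_map)
  ultimately show "cyc (\<lambda>a b. (a, b) \<in> parcs G) (map fst C)" using u by (simp add: cyc_def)
  show "length C = n" by (rule u(4))
  show "cycle_verts C \<subseteq> pverts G"
    using sub in_arcsD1 by (fastforce simp: cycle_verts_def)
qed

lemma cyc_imp_is_cycle:
  assumes "pair_wf_digraph G" "cyc (\<lambda>a b. (a, b) \<in> parcs G) xs"
  obtains C where "is_cycle G (length xs) C" "cycle_verts C = set xs"
proof -
  interpret pair_wf_digraph G by fact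
  obtain u zs where xs: "xs = u # zs" using assms(2) by (cases xs) (auto simp: cyc_def)
  \<comment> \<open>\<open>zip\<close> drops the last entry of the longer first list, so the final
    arc returns to \<open>u\<close>.\<close>
  define C where "C = zip (u # zs @ [u]) (zs @ [u])"
  have C: "pcas u C u" "set C \<subseteq> parcs G"
    using pcas_zip[of "parcs G" u "zs @ [u]"] assms(2) by (simp_all add: cyc_def circ_def xs C_def)
  have len: "length C = length xs" by (simp add: C_def xs)
  then have "C \<noteq> []" by (auto simp: xs)
  have "map snd C = zs @ [u]" unfolding C_def by (simp add: map_snd_zip_take)
  then have verts: "tl (awalk_verts u C) = zs @ [u]"
    using awalk_verts_conv'[OF C(1)] \<open>C \<noteq> []\<close> by simp
  have fst: "map fst C = xs" unfolding C_def by (simp add: map_fst_zip_take xs)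
  have "hd C \<in> parcs G" "fst (hd C) = u"
    using C \<open>C \<noteq> []\<close> by (cases C; auto)+
  then have "u \<in> pverts G" using arc_fst_in_verts by auto
  then have "awalk u C u" using C by (simp add: awalk_def)
  moreover have "distinct (tl (awalk_verts u C))"
    using assms(2) verts by (simp add: cyc_def xs)
  ultimately have "is_cycle G (length xs) C"
    using \<open>C \<noteq> []\<close> len assms(2) unfolding is_cycle_def cycle_def cyc_def by blast
  moreover have "cycle_verts C = set xs"
    unfolding cycle_verts_def fst[symmetric] by simp
  ultimately show thesis by (rule that)
qed

lemma gdist_eq_2:
  assumes "pair_wf_digraph G" "u \<noteq> v" "(u, v) \<notin> parcs G" "(u, w) \<in> parcs G" "(w, v) \<in> parcs G"
  shows "gdist G u v = 2"
proof -
  interpret pair_wf_digraph G by fact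
  have cost: "awalk_cost (\<lambda>_. 1) p = real (length p)" for p :: "('a \<times> 'a) list"
    by (induction p) simp_all
  have walk: "awalk u [(u, w), (w, v)] v"
    using in_arcsD1[OF assms(4)] assms(4,5) by (simp add: awalk_def)
  have "\<mu> (\<lambda>_. 1) u v \<le> 2"
    using min_cost_le_walk_cost[OF walk, of "\<lambda>_. 1"] by simp
  moreover have "2 \<le> ereal (awalk_cost (\<lambda>_. 1) p)" if "awalk u p v" for p
  proof -
    have "p \<noteq> []" using that assms(2) by (auto simp: awalk_def)
    moreover have "p \<noteq> [e]" for e
      using that assms(3) by (cases e) (auto simp: awalk_def)
    ultimately have "2 \<le> length p" by (cases p rule: remdups_adj.cases) auto
    then show ?thesis unfolding cost by simp
  qed
  then have "2 \<le> \<mu> (\<lambda>_. 1) u v" unfolding \<mu>_def by (intro INF_greatest) auto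
  ultimately show ?thesis unfolding gdist_def by (rule antisym)
qed

lemma card_diff_le_if_L1:
  assumes "finite A" "finite B" "finite D"
    and "int (card A) + int (card B) \<ge> int (card (A \<union> B \<union> D)) - 1"
  shows "card (D - (A \<union> B)) \<le> Suc (card (A \<inter> B))"
proof -
  have "A \<union> B \<union> D = (A \<union> B) \<union> (D - (A \<union> B))" by blast
  then have "card (A \<union> B \<union> D) = card (A \<union> B) + card (D - (A \<union> B))"
    using card_Un_disjoint[of "A \<union> B" "D - (A \<union> B)"] assms(1-3) by auto
  then show ?thesis using card_Un_Int[OF assms(1,2)] assms(4) by simp
qed

lemma ex_crossing_arc:
  assumes "pair_sym_digraph G" "Digraph_Component.connected (with_proj G)"
    and "a \<in> S" "a \<in> pverts G" "b \<notin> S" "b \<in> pverts G"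
  obtains x y where "x \<in> S" "y \<notin> S" "(x, y) \<in> parcs G"
proof (rule ccontr)
  interpret pair_sym_digraph G by fact
  assume "\<not> thesis"
  then have cl: "y \<in> S" if "(x, y) \<in> parcs G" "x \<in> S" for x y
    using that \<open>\<And>x y. x \<in> S \<Longrightarrow> y \<notin> S \<Longrightarrow> (x, y) \<in> parcs G \<Longrightarrow> thesis\<close> by blast
  \<comment> \<open>\<open>connected\<close> refers to the symmetric closure, which adds no arcs
    here.\<close>
  have parcs: "parcs (mk_symmetric (with_proj G)) = parcs G"
    using arcs_symmetric unfolding mk_symmetric_def by auto
  have "a \<rightarrow>\<^sup>*\<^bsub>with_proj (mk_symmetric (with_proj G))\<^esub> b"
    using assms unfolding connected_def strongly_connected_def by (simp add: mk_symmetric_def)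
  then have "(a, b) \<in> (parcs G)\<^sup>*"
    using reachable_rtranclI parcs by fastforce
  then have "b \<in> S" by (induction rule: rtrancl_induct) (use cl assms(3) in auto)
  then show False using assms(5) by contradiction
qed

lemma class_K_I:
  assumes "pair_bidirected_digraph G" "pverts G = P \<union> Q" "P \<inter> Q = {}"
    and "finite P" "finite Q" "2 \<le> card P" "card Q = card P + 1"
    and PQ: "\<And>x y. x \<in> P \<Longrightarrow> y \<in> Q \<Longrightarrow> (x, y) \<in> parcs G"
    and indep: "\<And>x y. x \<in> Q \<Longrightarrow> y \<in> Q \<Longrightarrow> (x, y) \<notin> parcs G"
  shows "G \<in> class_K"
proof -
  interpret pair_bidirected_digraph G by fact
  define H where "H = \<lparr>pverts = P \<union> Q, parcs = P \<times> Q \<union> Q \<times> P\<rparr>"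
  define A where "A = \<lparr>pverts = P, parcs = {(u, v). (u, v) \<in> P \<times> P \<and> u \<noteq> v}\<rparr>"
  define B :: "'a pair_pre_digraph" where "B = \<lparr>pverts = Q, parcs = {}\<rparr>"
  have wf: "wf_digraph (with_proj G)" by unfold_locales
  have arcs: "(u, v) \<in> P \<times> P \<and> u \<noteq> v \<or> (u, v) \<in> P \<times> Q \<union> Q \<times> P" if "(u, v) \<in> parcs G" for u v
    using in_arcsD1[OF that] in_arcsD2[OF that] no_loops'[OF that] indep that unfolding assms(2)
    by blast
  have "complete_bipartite_digraph (card P) (card P + 1) (with_proj H)"
    unfolding complete_bipartite_digraph_pair_def using assms(3-7) by (auto simp: H_def)
  moreover have "complete_digraph (card P) (with_proj A)"
    unfolding complete_digraph_pair_def using assms(4) by (auto simp: A_def)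
  moreover have "edgeless (card P + 1) B" "pverts A \<inter> pverts B = {}"
    using assms(3,5,7) by (auto simp: edgeless_def A_def B_def)
  moreover have "wf_digraph (with_proj H)"
    unfolding wf_digraph_wp_iff by unfold_locales (auto simp: H_def)
  then have "subgraph (with_proj H) (with_proj G)"
    using wf PQ arcs_symmetric assms(2) by (auto simp: subgraph_def H_def)
  moreover have "wf_digraph (with_proj (graph_join A B))"
    unfolding wf_digraph_wp_iff by unfold_locales (auto simp: graph_join_def A_def B_def)
  then have "subgraph (with_proj G) (with_proj (graph_join A B))"
    using wf arcs assms(2)
    by (auto simp: subgraph_def graph_join_def A_def B_def simp del: mem_Sigma_iff)
  ultimately show ?thesis
    unfolding class_K_def using assms(1,6) by blast
qed

theorem theorem1:
  fixes G :: "'a pair_pre_digraph" and n :: nat and C :: "('a \<times> 'a) awalk"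
  assumes "L1_graph G"
    and "Digraph_Component.connected (with_proj G)"
    and "locally_finite G"
    and "infinite (pverts G) \<or> card (pverts G) \<ge> 3"
    and "\<And>u v. u \<in> pverts G \<Longrightarrow> v \<in> pverts G \<Longrightarrow> gdist G u v = 2 \<Longrightarrow>
           card (nbhd G u \<inter> nbhd G v) \<ge> 2"
    and "is_cycle G n C"
    and "cycle_verts C \<noteq> pverts G"
    and "\<not> (finite (pverts G) \<and> n + 1 = card (pverts G) \<and> G \<in> class_K)"
  shows "\<exists>l C'. 1 \<le> l \<and> l \<le> 2 \<and> is_cycle G (n + l) C' \<and> cycle_verts C \<subset> cycle_verts C'"
proof (rule ccontr)
  assume no_ext: "\<not> ?thesis"
  have bi: "pair_bidirected_digraph G" using assms(1) by (simp add: L1_graph_def)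
  interpret pair_bidirected_digraph G by (rule bi)
  have wf: "pair_wf_digraph G" and sg: "pair_sym_digraph G" by unfold_locales
  define E where "E = (\<lambda>a b. (a, b) \<in> parcs G)"
  define xs where "xs = map fst C"
  have C_cyc: "cyc E xs" "length xs = n" "set xs \<subseteq> pverts G" "set xs = cycle_verts C"
    using is_cycle_imp_cyc[OF wf assms(6)] by (auto simp: E_def xs_def cycle_verts_def)
  have nb: "nbhd G u = {v. E u v}" for u by (simp add: nbhd_def E_def)
  \<comment> \<open>The locale \<open>ore\<close> wants finiteness on the whole type; elements that
    are not vertices have no neighbours.\<close>
  have fin: "finite {v. E u v}" for u
  proof (cases "u \<in> pverts G")
    case True
    then show ?thesis using assms(3) by (simp add: locally_finite_def nb)
  next
    case False
    then have "{v. E u v} = {}" using in_arcsD1 unfolding E_def by blast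
    then show ?thesis by simp
  qed
  have adj: "adjacency E"
    unfolding E_def using arcs_symmetric no_loops' by (intro adjacency.intro) blast+
  have N: "adjacency.N E u = nbhd G u" for u
    using adjacency.N_def[OF adj] by (simp add: nb)
  have dist2: "gdist G u v = 2" "u \<in> pverts G" "v \<in> pverts G" "w \<in> pverts G"
    if "u \<noteq> v" "\<not> E u v" "E u w" "E v w" for u v w
    using gdist_eq_2[OF wf that(1)] that arcs_symmetric in_arcsD1 in_arcsD2 by (auto simp: E_def)
  have ore: "ore E"
  proof (intro ore.intro ore_axioms.intro adj)
    fix x
    show "finite (adjacency.N E x)" using fin by (simp add: N nb)
  next
    fix u v w assume uvw: "u \<noteq> v" "\<not> E u v" "E u w" "E v w"
    note d = dist2[OF uvw]
    show "2 \<le> card (adjacency.N E u \<inter> adjacency.N E v)"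
      using assms(5)[OF d(2,3,1)] by (simp add: N)
    have "int (deg G u) + int (deg G v) \<ge> int (card (nbhd G u \<union> nbhd G v \<union> nbhd G w)) - 1"
      using assms(1) d uvw unfolding L1_graph_def by (simp add: nb)
    then show "card (adjacency.N E w - (adjacency.N E u \<union> adjacency.N E v))
        \<le> Suc (card (adjacency.N E u \<inter> adjacency.N E v))"
      using fin unfolding N deg_def by (intro card_diff_le_if_L1) (simp_all add: nb)
  qed
  \<comment> \<open>A covering cycle \<open>ys\<close> with at most \<open>n + 2\<close> vertices
    would be the required one, with \<open>l = length ys - n\<close>. This works for every outside
    vertex, as \<open>stuck\<close> demands.\<close>
  have sat: "saturated E (insert y (set xs))" if y: "y \<notin> set xs" for y
    unfolding saturated_def
  proof (intro allI impI)
    fix ys assume ys: "cyc E ys" "insert y (set xs) \<subseteq> set ys"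
    obtain C' where C': "is_cycle G (length ys) C'" "cycle_verts C' = set ys"
      using cyc_imp_is_cycle[OF wf] ys(1) unfolding E_def by metis
    have "distinct xs" "distinct ys" using C_cyc(1) ys(1) by (simp_all add: cyc_def)
    then have card: "card (insert y (set xs)) = Suc n" "card (set ys) = length ys"
      using y C_cyc(2) by (simp_all add: distinct_card)
    have "n < length ys" using card_mono[OF _ ys(2)] card by simp
    show "Suc (card (insert y (set xs))) < length ys"
    proof (rule ccontr)
      assume "\<not> ?thesis"
      then have "1 \<le> length ys - n" "length ys - n \<le> 2" "n + (length ys - n) = length ys"
        using \<open>n < length ys\<close> card by auto
      moreover have "cycle_verts C \<subset> cycle_verts C'" using ys(2) y C'(2) C_cyc(4) by auto
      ultimately show False using no_ext C'(1) by metis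
    qed
  qed
  have "set xs \<noteq> {}" using C_cyc(1) by (auto simp: cyc_def)
  then obtain a where a: "a \<in> set xs" by (meson ex_in_conv)
  have "\<not> pverts G \<subseteq> set xs" using assms(7) C_cyc(3,4) by (metis subset_antisym)
  then obtain b where b: "b \<notin> set xs" "b \<in> pverts G" by (meson subsetI)
  obtain x0 v where v: "x0 \<in> set xs" "v \<notin> set xs" "(x0, v) \<in> parcs G"
    using ex_crossing_arc[OF sg assms(2) a subsetD[OF C_cyc(3) a] b] by metis
  have "E v x0" using v(3) arcs_symmetric by (simp add: E_def)
  interpret ore_stuck E xs v x0
    by (intro ore_stuck.intro ore_outside.intro outside_vertex.intro outside_vertex_axioms.intro
        ore_outside_axioms.intro ore_stuck_axioms.intro adj ore C_cyc(1) v sat \<open>E v x0\<close>)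
  have all: "pverts G = insert v (set xs)"
  proof
    show "insert v (set xs) \<subseteq> pverts G" using C_cyc(3) v(3) in_arcsD2 by auto
    show "pverts G \<subseteq> insert v (set xs)"
    proof (rule ccontr)
      assume "\<not> ?thesis"
      then obtain z where z: "z \<in> pverts G" "z \<notin> insert v (set xs)" by blast
      obtain x y where "x \<in> insert v (set xs)" "y \<notin> insert v (set xs)" "E x y"
        using ex_crossing_arc[OF sg assms(2) insertI2[OF a] subsetD[OF C_cyc(3) a] z(2,1)]
        unfolding E_def by metis
      then show False using closed by blast
    qed
  qed
  have WQ: "W \<subseteq> set xs" by (auto simp: W_iff)
  have PQ: "E x y" if "x \<in> W" "y \<in> insert v (set xs - W)" for x y
    using that complete[of y x] E_commute[of x y] W_iff[of x] by blast
  have indep: "\<not> E x y"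
    if "x \<in> insert v (set xs - W)" "y \<in> insert v (set xs - W)" for x y
    using that independent[of x y] E_commute[of x y] irrefl[of v] W_iff[of x] W_iff[of y] by blast
  \<comment> \<open>With p the size of \<open>W\<close>, the independent part consists of
    \<open>v\<close> and the other half of the cycle, p + 1 vertices in all.\<close>
  have "G \<in> class_K"
  proof (rule class_K_I[OF bi, of W "insert v (set xs - W)"])
    show "card (insert v (set xs - W)) = card W + 1" using v_notin card_complement by simp
    show "pverts G = W \<union> insert v (set xs - W)" using all WQ by auto
    show "W \<inter> insert v (set xs - W) = {}" using v_notin WQ by auto
    show "(x, y) \<in> parcs G" if "x \<in> W" "y \<in> insert v (set xs - W)" for x y
      using PQ[OF that] by (simp add: E_def)
    show "(x, y) \<notin> parcs G" if "x \<in> insert v (set xs - W)" "y \<in> insert v (set xs - W)" for x y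
      using indep[OF that] by (simp add: E_def)
  qed (use finite_W two_le_card_W in auto)
  moreover have "finite (pverts G)" "card (pverts G) = n + 1"
    unfolding all using v_notin distinct_card[OF dist] C_cyc(2) by auto
  ultimately show False using assms(8) by simp
qed

end
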